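(* Let $\mathbb{k}$ be a nontrivial semiring and let $K, L, Z, W$ be simplicial complexes over a type $E$. If $K \cong_{\mathrm{st}} L$ and $Z \cong_{\mathrm{st}} W$ (over $E$), then $K \star Z \cong_{\mathrm{st}} L \star W$ (over $E \times \mathbb{k}$).
   Context: A simplicial complex over a type (set) $E$ is a set $K$ of nonempty finite subsets of $E$ (its faces) such that every nonempty subset of a face is a face. It may be empty or infinite, and not every element of $E$ need be a vertex. $V(K) = \{x \in E \mid \{x\} \in K\}$. For a finite set $s \subseteq E$: $\mathrm{Lk}(K,s) = \{t \in K \mid s \cup t \in K,\ s \cap t = \emptyset\}$; $\partial s = \{t \subseteq s \mid t \ne \emptyset,\ t \neq s\}$. For finite $s,t \subseteq E$, $s \sqcup_s t = (s \times \{0\}) \cup (t \times \{1\}) \subseteq E \times \mathbb{k}$. The join $K \star L$ of complexes over $E$ is the complex over $E \times \mathbb{k}$ with faces $\{s \sqcup_s t \mid s \in K \cup \{\emptyset\},\ t \in L \cup \{\emptyset\}\} \setminus \{\emptyset\}$. A simplicial map from $K$ (over $E$) to $L$ (over $F$) is a function $E \to F$ sending each face of $K$ to a face of $L$. $K \cong L$ (isomorphism) means there are simplicial maps $f : E \to F$ from $K$ to $L$ and $g : F \to E$ from $L$ to $K$ with $g(f(x)) = x$ for all $x \in V(K)$ and $f(g(y)) = y$ for all $y \in V(L)$. For $s \in K$ and $x \in E \setminus V(K)$, the stellar subdivision $\sigma_s K$ of $K$ at $s$ with barycenter $x$ is the complex over $E$ whose faces are the faces of $K$ not containing $s$ together with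 all nonempty sets $a \cup b \cup c$ with $a \in \mathrm{Lk}(K,s) \cup \{\emptyset\}$, $b \in \partial s \cup \{\emptyset\}$, $c \in \{\emptyset, \{x\}\}$. For complexes $K, L$ over the same type $E$, there is a stellar move from $K$ to $L$ if $L$ is a stellar subdivision of $K$ (for some face $s$ of $K$ and some barycenter in $E \setminus V(K)$), or $K$ is a stellar subdivision of $L$ (a stellar weld), or $K \cong L$. Stellar equivalence $\cong_{\mathrm{st}}$ is the reflexive transitive closure of the stellar move relation on complexes over a fixed type. *)

theory Defs
  imports Main
begin

text \<open>
  A complex over a type is represented by its set of faces. The ground set is the whole type
  \<open>'a\<close>, so not every element of \<open>'a\<close> is a vertex; the complex may be empty or infinite.
\<close>

definition simplicial_complex :: "'a set set \<Rightarrow> bool" where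
  "simplicial_complex K \<longleftrightarrow>
     (\<forall>s\<in>K. finite s \<and> s \<noteq> {}) \<and> (\<forall>s\<in>K. \<forall>t. t \<subseteq> s \<and> t \<noteq> {} \<longrightarrow> t \<in> K)"

definition vertices :: "'a set set \<Rightarrow> 'a set" where
  "vertices K = {x. {x} \<in> K}"

definition link :: "'a set set \<Rightarrow> 'a set \<Rightarrow> 'a set set" where
  "link K s = {t \<in> K. s \<union> t \<in> K \<and> s \<inter> t = {}}"

definition boundary :: "'a set \<Rightarrow> 'a set set" where
  "boundary s = {t. t \<subseteq> s \<and> t \<noteq> {} \<and> t \<noteq> s}"

text \<open>
  The class \<open>semiring_1\<close> is that of unital semirings with \<open>0 \<noteq> 1\<close>, i.e. nontrivial semirings;
  it does not assume commutativity of multiplication.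
\<close>

definition disj_union :: "'a set \<Rightarrow> 'a set \<Rightarrow> ('a \<times> 'k::semiring_1) set" where
  "disj_union s t = s \<times> {0} \<union> t \<times> {1}"

definition complex_join :: "'a set set \<Rightarrow> 'a set set \<Rightarrow> ('a \<times> 'k::semiring_1) set set" where
  "complex_join K L = {disj_union s t | s t. s \<in> K \<union> {{}} \<and> t \<in> L \<union> {{}}} - {{}}"

definition simplicial_map :: "'a set set \<Rightarrow> 'b set set \<Rightarrow> ('a \<Rightarrow> 'b) \<Rightarrow> bool" where
  "simplicial_map K L f \<longleftrightarrow> (\<forall>s\<in>K. f ` s \<in> L)"

definition complex_iso :: "'a set set \<Rightarrow> 'b set set \<Rightarrow> bool" where
  "complex_iso K L \<longleftrightarrow>
     (\<exists>f g. simplicial_map K L f \<and> simplicial_map L K g \<and>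
            (\<forall>x\<in>vertices K. g (f x) = x) \<and> (\<forall>y\<in>vertices L. f (g y) = y))"

definition stellar_subdivision :: "'a set set \<Rightarrow> 'a set \<Rightarrow> 'a \<Rightarrow> 'a set set" where
  "stellar_subdivision K s x =
     {t \<in> K. \<not> s \<subseteq> t} \<union>
     ({a \<union> b \<union> c | a b c.
         a \<in> link K s \<union> {{}} \<and> b \<in> boundary s \<union> {{}} \<and> c \<in> {{}, {x}}} - {{}})"

definition is_stellar_subdivision :: "'a set set \<Rightarrow> 'a set set \<Rightarrow> bool" where
  "is_stellar_subdivision K L \<longleftrightarrow> (\<exists>s\<in>K. \<exists>x. x \<notin> vertices K \<and> L = stellar_subdivision K s x)"

text \<open>
  The relation is one between complexes, whence the two guards; every intermediate term of a
  chain of moves is thus a complex.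
\<close>

definition stellar_move :: "'a set set \<Rightarrow> 'a set set \<Rightarrow> bool" where
  "stellar_move K L \<longleftrightarrow>
     simplicial_complex K \<and> simplicial_complex L \<and>
     (is_stellar_subdivision K L \<or> is_stellar_subdivision L K \<or> complex_iso K L)"

definition stellar_equiv :: "'a set set \<Rightarrow> 'a set set \<Rightarrow> bool" where
  "stellar_equiv = stellar_move\<^sup>*\<^sup>*"

lemma simplicial_complexD:
  assumes "simplicial_complex K" "s \<in> K"
  shows "finite s" "s \<noteq> {}" "\<And>t. t \<subseteq> s \<Longrightarrow> t \<noteq> {} \<Longrightarrow> t \<in> K"
  using assms unfolding simplicial_complex_def by blast+

lemma simplicial_complex_join:
  assumes K: "simplicial_complex K" and L: "simplicial_complex L"
  shows "simplicial_complex (complex_join K L :: ('a \<times> 'k::semiring_1) set set)"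
proof -
  have "finite s \<and> s \<noteq> {} \<and> (\<forall>t. t \<subseteq> s \<and> t \<noteq> {} \<longrightarrow> t \<in> complex_join K L)"
    if s: "s \<in> complex_join K L" for s :: "('a \<times> 'k) set"
  proof (intro conjI allI impI)
    from s obtain u v where uv: "s = disj_union u v" "u \<in> K \<union> {{}}" "v \<in> L \<union> {{}}"
      by (auto simp: complex_join_def)
    have "finite u" "finite v"
      using uv(2,3) simplicial_complexD(1)[OF K] simplicial_complexD(1)[OF L] by auto
    then show "finite s" by (simp add: uv(1) disj_union_def)
    show "s \<noteq> {}" using s by (simp add: complex_join_def)
    fix t assume t: "t \<subseteq> s \<and> t \<noteq> {}"
    define u' v' where "u' = {x. (x, 0) \<in> t}" and "v' = {x. (x, 1) \<in> t}"
    have eq: "t = disj_union u' v'" and sub: "u' \<subseteq> u" "v' \<subseteq> v"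
      using t uv(1) by (auto simp: disj_union_def u'_def v'_def)
    have "u' \<in> K \<union> {{}}"
      using uv(2) sub(1) simplicial_complexD(3)[OF K, of u u'] by auto
    moreover have "v' \<in> L \<union> {{}}"
      using uv(3) sub(2) simplicial_complexD(3)[OF L, of v v'] by auto
    ultimately show "t \<in> complex_join K L"
      using t eq by (auto simp: complex_join_def)
  qed
  then show ?thesis unfolding simplicial_complex_def by blast
qed

lemma simplicial_complex_stellar_subdivision:
  assumes K: "simplicial_complex K" and s: "s \<in> K"
  shows "simplicial_complex (stellar_subdivision K s x)"
proof -
  define N where "N = {a \<union> b \<union> c | a b c.
     a \<in> link K s \<union> {{}} \<and> b \<in> boundary s \<union> {{}} \<and> c \<in> {{}, {x}}}"
  have S: "stellar_subdivision K s x = {t \<in> K. \<not> s \<subseteq> t} \<union> (N - {{}})"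
    by (simp add: stellar_subdivision_def N_def)
  have link: "u \<in> link K s \<union> {{}}" if "a \<in> link K s \<union> {{}}" "u \<subseteq> a" for a u
  proof (cases "u = {}")
    case False
    then have a: "a \<in> K" "s \<union> a \<in> K" "s \<inter> a = {}"
      using that by (auto simp: link_def)
    have "u \<in> K" using simplicial_complexD(3)[OF K a(1) that(2) False] .
    moreover have "s \<union> u \<in> K"
      by (rule simplicial_complexD(3)[OF K a(2)]) (use that(2) False in auto)
    moreover have "s \<inter> u = {}" using a(3) that(2) by auto
    ultimately show ?thesis by (simp add: link_def)
  qed simp
  have N: "finite t \<and> (\<forall>u\<subseteq>t. u \<in> N)" if "t \<in> N" for t
  proof -
    from that obtain a b c where abc: "t = a \<union> b \<union> c" "a \<in> link K s \<union> {{}}"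
      "b \<in> boundary s \<union> {{}}" "c \<in> {{}, {x}}"
      unfolding N_def mem_Collect_eq by (elim exE conjE) (rule that)
    have "finite a" using abc(2) simplicial_complexD(1)[OF K] by (auto simp: link_def)
    moreover have "b \<subseteq> s" using abc(3) by (auto simp: boundary_def)
    then have "finite b" using simplicial_complexD(1)[OF K s] by (rule finite_subset)
    moreover have "finite c" using abc(4) by auto
    moreover have "u \<in> N" if u: "u \<subseteq> t" for u
    proof -
      have "u = (u \<inter> a) \<union> (u \<inter> b) \<union> (u \<inter> c)" using u abc(1) by auto
      moreover have "u \<inter> a \<in> link K s \<union> {{}}" by (rule link[OF abc(2)]) simp
      moreover have "u \<inter> b \<in> boundary s \<union> {{}}" using abc(3) by (auto simp: boundary_def)
      moreover have "u \<inter> c \<in> {{}, {x}}" using abc(4) by auto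
      ultimately show ?thesis unfolding N_def mem_Collect_eq by (intro exI conjI)
    qed
    ultimately show ?thesis by (simp add: abc(1))
  qed
  have "finite t \<and> t \<noteq> {} \<and> (\<forall>u. u \<subseteq> t \<and> u \<noteq> {} \<longrightarrow> u \<in> stellar_subdivision K s x)"
    if "t \<in> stellar_subdivision K s x" for t
  proof (cases "t \<in> K \<and> \<not> s \<subseteq> t")
    case True
    then show ?thesis
      using simplicial_complexD[OF K, of t] unfolding S by blast
  next
    case False
    then have "t \<in> N" "t \<noteq> {}" using that by (auto simp: S)
    then show ?thesis using N[of t] by (simp add: S)
  qed
  then show ?thesis unfolding simplicial_complex_def by blast
qed

end

theory Submission
  imports Defs
begin

text \<open>
  Taking the join with a fixed complex on the right carries each stellar move on the left factor
  to a move of the same kind: subdividing at \<open>s\<close> with barycenter \<open>x\<close> becomes subdividing at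
  \<open>s \<times> {0}\<close> with barycenter \<open>(x, 0)\<close>. The right factor is reduced to the left one because
  exchanging the two factors is an isomorphism, hence itself a stellar move.
\<close>

section \<open>Faces of a join and their fibres\<close>

text \<open>Inverts \<open>disj_union\<close>: the fibres over 0 and 1 are the two factors of a face
  of a join.\<close>

definition fibre :: "'k \<Rightarrow> ('a \<times> 'k) set \<Rightarrow> 'a set" where
  "fibre i t = {x. (x, i) \<in> t}"

lemma fibre_disj_union [simp]:
  "fibre 0 (disj_union u v) = u" "fibre (1::'k::semiring_1) (disj_union u v) = v"
  by (auto simp: fibre_def disj_union_def)

lemma disj_union_fibres:
  fixes t :: "('a \<times> 'k::semiring_1) set"
  assumes "t \<subseteq> UNIV \<times> {0, 1}"
  shows "disj_union (fibre 0 t) (fibre 1 t) = t"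
  using assms by (auto simp: fibre_def disj_union_def)

text \<open>Since 0 and 1 differ, a face determines its two factors, so the existential description
  of the join becomes a condition on \<open>t\<close> itself. The inclusion in
  \<open>UNIV \<times> {0, 1}\<close> excludes points with other labels, which these two fibres do
  not see.\<close>

lemma mem_complex_join_iff:
  fixes t :: "('a \<times> 'k::semiring_1) set"
  shows "t \<in> complex_join K L \<longleftrightarrow>
    t \<noteq> {} \<and> t \<subseteq> UNIV \<times> {0, 1} \<and> fibre 0 t \<in> K \<union> {{}} \<and> fibre 1 t \<in> L \<union> {{}}"
    (is "_ \<longleftrightarrow> ?R")
proof
  assume "t \<in> complex_join K L"
  then obtain u v where "t = disj_union u v" "t \<noteq> {}" "u \<in> K \<union> {{}}" "v \<in> L \<union> {{}}"
    by (auto simp: complex_join_def)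
  moreover have "disj_union u v \<subseteq> (UNIV \<times> {0, 1} :: ('a \<times> 'k) set)"
    by (auto simp: disj_union_def)
  ultimately show ?R by simp
next
  assume R: ?R
  then have "t = disj_union (fibre 0 t) (fibre 1 t)"
    by (simp add: disj_union_fibres)
  with R show "t \<in> complex_join K L"
    unfolding complex_join_def by blast
qed

lemma disj_union_mem_complex_join:
  "u \<in> K \<union> {{}} \<Longrightarrow> v \<in> L \<union> {{}} \<Longrightarrow> disj_union u v \<noteq> ({} :: ('a \<times> 'k::semiring_1) set) \<Longrightarrow>
    (disj_union u v :: ('a \<times> 'k) set) \<in> complex_join K L"
  unfolding complex_join_def by blast

lemma vertices_complex_join:
  "vertices (complex_join K L :: ('a \<times> 'k::semiring_1) set set) =
    vertices K \<times> {0} \<union> vertices L \<times> {1}"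
proof -
  have "fibre i {(x, j)} = (if i = j then {x} else {})" for i j :: 'k and x :: 'a
    by (auto simp: fibre_def)
  then show ?thesis
    by (auto simp: vertices_def mem_complex_join_iff)
qed

section \<open>Stellar subdivision of the left factor\<close>

text \<open>As \<open>x\<close> lies in no face of \<open>K\<close>, a new face
  \<open>a \<union> b \<union> c\<close> splits in only one way: \<open>c = t \<inter> {x}\<close>,
  \<open>b = t \<inter> s\<close>, and \<open>a\<close> is the rest. The link condition on
  \<open>a\<close> then says that \<open>s \<union> a = s \<union> (t - {x})\<close> is a
  face.\<close>

lemma mem_stellar_subdivision_iff:
  assumes K: "simplicial_complex K" and s: "s \<in> K" and x: "x \<notin> vertices K"
  shows "t \<in> stellar_subdivision K s x \<longleftrightarrow>
    \<not> s \<subseteq> t \<and> (t \<in> K \<or> x \<in> t \<and> s \<union> (t - {x}) \<in> K)"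
    (is "_ \<longleftrightarrow> ?R")
proof -
  define N where "N = {a \<union> b \<union> c | a b c.
    a \<in> link K s \<union> {{}} \<and> b \<in> boundary s \<union> {{}} \<and> c \<in> {{}, {x}}}"
  have S: "stellar_subdivision K s x = {t \<in> K. \<not> s \<subseteq> t} \<union> (N - {{}})"
    by (simp add: stellar_subdivision_def N_def)
  have xK: "x \<notin> u" if "u \<in> K" for u
    using simplicial_complexD(3)[OF K that, of "{x}"] x by (auto simp: vertices_def)
  have ?R if "t \<in> stellar_subdivision K s x"
  proof (cases "t \<in> K \<and> \<not> s \<subseteq> t")
    case False
    then have "t \<in> N" and ne: "t \<noteq> {}" using that by (auto simp: S)
    then obtain a b c where abc: "t = a \<union> b \<union> c" "a \<in> link K s \<union> {{}}"
      "b \<in> boundary s \<union> {{}}" "c \<in> {{}, {x}}"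
      unfolding N_def mem_Collect_eq by (elim exE conjE) (rule that)
    have a: "s \<union> a \<in> K" "s \<inter> a = {}"
      using abc(2) s by (auto simp: link_def)
    have b: "b \<subset> s"
      using abc(3) simplicial_complexD(2)[OF K s] by (auto simp: boundary_def)
    have xa: "x \<notin> s \<union> a"
      by (rule xK[OF a(1)])
    have "\<not> s \<subseteq> t"
      using a(2) b xa abc(1,4) by auto
    \<comment> \<open>Without the barycenter, \<open>t = a \<union> b\<close> lies inside the face
      \<open>s \<union> a\<close>.\<close>
    moreover have "t \<in> K" if "x \<notin> t"
      by (rule simplicial_complexD(3)[OF K a(1)]) (use abc(1,4) ne b that in auto)
    moreover have "s \<union> (t - {x}) = s \<union> a"
      using abc(1,4) b xa by auto
    ultimately show ?R using a(1) by auto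
  qed simp
  moreover have "t \<in> stellar_subdivision K s x" if R: ?R
  proof (cases "t \<in> K")
    case True
    then show ?thesis using R by (simp add: S)
  next
    case False
    with R have t: "x \<in> t" "s \<union> (t - {x}) \<in> K" "\<not> s \<subseteq> t" by auto
    have xs: "x \<notin> s"
      using simplicial_complexD(3)[OF K s, of "{x}"] x by (auto simp: vertices_def)
    \<comment> \<open>The part of \<open>t\<close> outside \<open>s\<close> and \<open>x\<close>
      serves as \<open>a\<close>; it may be empty.\<close>
    have "s \<union> (t - {x} - s) = s \<union> (t - {x})" by auto
    then have "t - {x} - s \<in> link K s \<union> {{}}"
      using t(2) simplicial_complexD(3)[OF K t(2), of "t - {x} - s"]
      by (auto simp: link_def)
    moreover have "t \<inter> s \<in> boundary s \<union> {{}}"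
      using t(3) by (auto simp: boundary_def)
    moreover have "t = (t - {x} - s) \<union> (t \<inter> s) \<union> {x}"
      using t(1) xs by auto
    moreover have "{x} \<in> {{}, {x}}" by simp
    ultimately have "t \<in> N"
      unfolding N_def mem_Collect_eq by (intro exI conjI)
    then show ?thesis using t(1) by (auto simp: S)
  qed
  ultimately show ?thesis by blast
qed

text \<open>Adding \<open>s \<times> {0}\<close> and removing \<open>(x, 0)\<close> change only the
  fibre over 0, so both membership criteria reduce to the same condition on that fibre, with the
  same condition on the fibre over 1.\<close>

lemma stellar_subdivision_complex_join_left:
  fixes K Z :: "'a set set"
  assumes K: "simplicial_complex K" and Z: "simplicial_complex Z"
    and s: "s \<in> K" and x: "x \<notin> vertices K"
  shows "complex_join (stellar_subdivision K s x) Z =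
    stellar_subdivision (complex_join K Z :: ('a \<times> 'k::semiring_1) set set) (s \<times> {0}) (x, 0)"
proof (rule set_eqI)
  fix t :: "('a \<times> 'k) set"
  have s_ne: "s \<noteq> {}"
    by (rule simplicial_complexD(2)[OF K s])
  have s': "s \<times> {0} \<in> (complex_join K Z :: ('a \<times> 'k) set set)"
    using disj_union_mem_complex_join[of s K "{}" Z] s s_ne by (auto simp: disj_union_def)
  have x': "(x, 0) \<notin> vertices (complex_join K Z :: ('a \<times> 'k) set set)"
    using x by (simp add: vertices_complex_join)
  have sub: "s \<times> {0} \<subseteq> t \<longleftrightarrow> s \<subseteq> fibre 0 t"
    by (auto simp: fibre_def)
  have f: "fibre 0 (s \<times> {0} \<union> (t - {(x, 0)})) = s \<union> (fibre 0 t - {x})"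
    "fibre 1 (s \<times> {0} \<union> (t - {(x, 0)})) = fibre 1 t"
    "s \<times> {0} \<union> (t - {(x, 0)}) \<subseteq> UNIV \<times> {0, 1} \<longleftrightarrow> t \<subseteq> UNIV \<times> {0, 1}"
    "s \<times> {0} \<union> (t - {(x, 0)}) \<noteq> {}"
    using s_ne by (auto simp: fibre_def)
  have x0: "(x, 0) \<in> t \<longleftrightarrow> x \<in> fibre 0 t"
    by (simp add: fibre_def)
  \<comment> \<open>When the fibre over 0 is empty, \<open>t\<close> comes from \<open>Z\<close>
    alone; it survives the subdivision because \<open>s\<close> is nonempty and so not contained in
    that fibre.\<close>
  show "t \<in> complex_join (stellar_subdivision K s x) Z \<longleftrightarrow>
    t \<in> stellar_subdivision (complex_join K Z) (s \<times> {0}) (x, 0)"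
    unfolding mem_stellar_subdivision_iff[OF simplicial_complex_join[OF K Z] s' x']
      mem_complex_join_iff f sub x0
    using s_ne by (auto simp: mem_stellar_subdivision_iff[OF K s x] fibre_def)
qed

lemma is_stellar_subdivision_complex_join_left:
  fixes K L Z :: "'a set set"
  assumes K: "simplicial_complex K" and Z: "simplicial_complex Z"
    and "is_stellar_subdivision K L"
  shows "is_stellar_subdivision (complex_join K Z :: ('a \<times> 'k::semiring_1) set set)
    (complex_join L Z)"
proof -
  obtain s x where s: "s \<in> K" and x: "x \<notin> vertices K" and L: "L = stellar_subdivision K s x"
    using assms(3) by (auto simp: is_stellar_subdivision_def)
  have "s \<times> {0} \<in> (complex_join K Z :: ('a \<times> 'k) set set)"
    using disj_union_mem_complex_join[of s K "{}" Z] s simplicial_complexD(2)[OF K s]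
    by (auto simp: disj_union_def)
  moreover have "(x, 0) \<notin> vertices (complex_join K Z :: ('a \<times> 'k) set set)"
    using x by (simp add: vertices_complex_join)
  ultimately show ?thesis
    unfolding is_stellar_subdivision_def L stellar_subdivision_complex_join_left[OF K Z s x]
    by blast
qed

section \<open>Isomorphisms between joins\<close>

text \<open>Either factor may be empty, but not both: the image of a nonempty face is nonempty,
  which is all that membership in the target join still requires.\<close>

lemma simplicial_map_complex_joinI:
  assumes "\<And>u v. u \<in> K \<union> {{}} \<Longrightarrow> v \<in> Z \<union> {{}} \<Longrightarrow>
    \<exists>u'\<in>L \<union> {{}}. \<exists>v'\<in>W \<union> {{}}. h ` disj_union u v = disj_union u' v'"
  shows "simplicial_map (complex_join K Z :: ('a \<times> 'k::semiring_1) set set)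
    (complex_join L W :: ('b \<times> 'k) set set) h"
  unfolding simplicial_map_def
proof
  fix t :: "('a \<times> 'k) set"
  assume "t \<in> complex_join K Z"
  then obtain u v where t: "t = disj_union u v" "t \<noteq> {}" "u \<in> K \<union> {{}}" "v \<in> Z \<union> {{}}"
    by (auto simp: complex_join_def)
  with assms[OF t(3,4)] show "h ` t \<in> complex_join L W"
    by (metis disj_union_mem_complex_join image_is_empty)
qed

lemma complex_iso_complex_join_left:
  fixes K L :: "'a set set"
  assumes "complex_iso K L"
  shows "complex_iso (complex_join K Z :: ('a \<times> 'k::semiring_1) set set)
    (complex_join L Z :: ('a \<times> 'k) set set)"
proof -
  obtain f g where fg: "simplicial_map K L f" "simplicial_map L K g"
    "\<forall>x\<in>vertices K. g (f x) = x" "\<forall>y\<in>vertices L. f (g y) = y"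
    using assms by (auto simp: complex_iso_def)
  \<comment> \<open>The given map acts on the copy labelled 0; points with any other label are
    fixed, in particular the copy labelled 1.\<close>
  define h :: "('a \<Rightarrow> 'a) \<Rightarrow> 'a \<times> 'k \<Rightarrow> 'a \<times> 'k"
    where "h f p = (if snd p = 0 then (f (fst p), 0) else p)" for f p
  have img: "h f ` disj_union u v = disj_union (f ` u) v" for f u v
    by (force simp: h_def disj_union_def)
  have "simplicial_map (complex_join M Z) (complex_join N Z) (h f)"
    if "simplicial_map M N f" for M N f
    using that by (intro simplicial_map_complex_joinI) (auto simp: img simplicial_map_def)
  with fg(1,2) have "simplicial_map (complex_join K Z) (complex_join L Z) (h f)"
    "simplicial_map (complex_join L Z) (complex_join K Z) (h g)" by auto
  moreover have "\<forall>p\<in>vertices (complex_join K Z). h g (h f p) = p"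
    "\<forall>p\<in>vertices (complex_join L Z). h f (h g p) = p"
    using fg(3,4) by (auto simp: vertices_complex_join h_def)
  ultimately show ?thesis unfolding complex_iso_def by blast
qed

lemma complex_iso_complex_join_commute:
  fixes K Z :: "'a set set"
  shows "complex_iso (complex_join K Z :: ('a \<times> 'k::semiring_1) set set)
    (complex_join Z K :: ('a \<times> 'k) set set)"
proof -
  \<comment> \<open>Exchanges the labels 0 and 1. Every other label is sent to 0, so
    \<open>h\<close> need not be an involution on the whole type, but inverses are tested only on
    vertices, whose labels are 0 or 1.\<close>
  define h :: "'a \<times> 'k \<Rightarrow> 'a \<times> 'k" where "h p = (fst p, if snd p = 0 then 1 else 0)" for p
  have img: "h ` disj_union u v = disj_union v u" for u v
    by (force simp: h_def disj_union_def)
  have "simplicial_map (complex_join M N) (complex_join N M) h" for M N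
    by (intro simplicial_map_complex_joinI) (auto simp: img)
  moreover have "\<forall>p\<in>vertices (complex_join M N). h (h p) = p" for M N
    by (auto simp: vertices_complex_join h_def)
  ultimately show ?thesis unfolding complex_iso_def by blast
qed

section \<open>Stellar moves and stellar equivalence of joins\<close>

text \<open>A weld is the subdivision case with \<open>K\<close> and \<open>L\<close> exchanged; the
  guards in \<open>stellar_move\<close> supply that both are complexes.\<close>

lemma stellar_move_complex_join_left:
  fixes K L Z :: "'a set set"
  assumes "simplicial_complex Z" and "stellar_move K L"
  shows "stellar_move (complex_join K Z :: ('a \<times> 'k::semiring_1) set set) (complex_join L Z)"
  using assms unfolding stellar_move_def
  by (blast intro: simplicial_complex_join is_stellar_subdivision_complex_join_left
      complex_iso_complex_join_left)

lemma stellar_equiv_complex_join_left: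
  fixes K L Z :: "'a set set"
  assumes "simplicial_complex Z" and "stellar_equiv K L"
  shows "stellar_equiv (complex_join K Z :: ('a \<times> 'k::semiring_1) set set) (complex_join L Z)"
  using assms(2) unfolding stellar_equiv_def
proof induction
  case (step L M)
  then show ?case
    using stellar_move_complex_join_left[OF assms(1)] by (meson rtranclp.rtrancl_into_rtrancl)
qed simp

lemma stellar_equiv_complex_join_commute:
  fixes K Z :: "'a set set"
  assumes "simplicial_complex K" and "simplicial_complex Z"
  shows "stellar_equiv (complex_join K Z :: ('a \<times> 'k::semiring_1) set set) (complex_join Z K)"
  using assms complex_iso_complex_join_commute simplicial_complex_join
  unfolding stellar_equiv_def stellar_move_def by blast

theorem proposition3p6:
  fixes K L Z W :: "'a set set"
  assumes "simplicial_complex K" and "simplicial_complex L"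
    and "simplicial_complex Z" and "simplicial_complex W"
    and "stellar_equiv K L" and "stellar_equiv Z W"
  shows "stellar_equiv (complex_join K Z :: ('a \<times> 'k::semiring_1) set set) (complex_join L W)"
proof -
  let ?J = "complex_join :: 'a set set \<Rightarrow> 'a set set \<Rightarrow> ('a \<times> 'k) set set"
  \<comment> \<open>Once \<open>K\<close> has become \<open>L\<close>, a swap brings
    \<open>Z\<close> to the left, where it is replaced by \<open>W\<close> with \<open>L\<close>
    held fixed; a second swap restores the order.\<close>
  have "stellar_equiv (?J K Z) (?J L Z)"
    by (rule stellar_equiv_complex_join_left[OF assms(3,5)])
  moreover have "stellar_equiv (?J L Z) (?J Z L)"
    by (rule stellar_equiv_complex_join_commute[OF assms(2,3)])
  moreover have "stellar_equiv (?J Z L) (?J W L)"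
    by (rule stellar_equiv_complex_join_left[OF assms(2,6)])
  moreover have "stellar_equiv (?J W L) (?J L W)"
    by (rule stellar_equiv_complex_join_commute[OF assms(4,2)])
  ultimately show ?thesis
    unfolding stellar_equiv_def by (meson rtranclp_trans)
qed

end
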